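(* Let $M$ be a smooth manifold of dimension $n\ge 2$, and let $F:A\to(0,\infty)$ be a function on a subset $A\subset TM$. Then $F$ is a U-Kropina metric if and only if there are a Riemannian metric $h$ on $M$ and a vector field $W$ on $M$ with $h(W,W)=1$ everywhere such that $F$ is the solution of Zermelo's navigation problem on the Riemannian manifold $(M,h)$ under the influence of the wind $W$.
   Context: U-Kropina metric: let $h=(h_{ij})$ be a Riemannian metric on $M$, $W=W^i\frac{\partial}{\partial x^i}$ a globally defined smooth vector field on $M$ with $h(W,W)=1$ everywhere, $W_i=h_{ij}W^j$, and $k$ a smooth function on $M$. Put $a_{ij}=e^{-k(x)}h_{ij}$, $b_i=2e^{-k(x)}W_i$, $\alpha(x,y)=\sqrt{a_{ij}(x)y^iy^j}$, $\beta(x,y)=b_i(x)y^i$. The function $F=\alpha^2/\beta$ on the set $A=\{(x,y)\in TM:\beta(x,y)>0\}$ is called a U-Kropina metric (Kropina metric with unit vector field). A function is a U-Kropina metric if it arises this way for some $h,W,k$. Solution of Zermelo's navigation problem for $(h,W)$ with $h(W,W)=1$: the function $F$ whose domain $A$ is the set of $(x,y)\in TM$, $y\ne0$, for which there is a positive number $F(x,y)$ satisfying $\left|\frac{y}{F(x,y)}-W_x\right|=1$, where $|v|=\sqrt{h(v,v)}$, and whose value is this number. *)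

theory Defs
  imports "HOL-Analysis.Analysis"
begin

section \<open>Smooth maps between Euclidean spaces\<close>

text \<open>Both notions are used for open sets \<open>S\<close> only, where they do not depend on the
  values of \<open>f\<close> outside \<open>S\<close>.\<close>

fun Ck_on :: "nat \<Rightarrow> 'a::euclidean_space set \<Rightarrow> ('a \<Rightarrow> 'b::real_normed_vector) \<Rightarrow> bool" where
  "Ck_on 0 S f \<longleftrightarrow> continuous_on S f"
| "Ck_on (Suc k) S f \<longleftrightarrow>
     (\<forall>x\<in>S. f differentiable (at x)) \<and> (\<forall>v. Ck_on k S (\<lambda>x. frechet_derivative f (at x) v))"

definition smooth_on :: "'a::euclidean_space set \<Rightarrow> ('a \<Rightarrow> 'b::real_normed_vector) \<Rightarrow> bool" where
  "smooth_on S f \<longleftrightarrow> (\<forall>k. Ck_on k S f)"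

section \<open>Smooth manifolds\<close>

text \<open>A chart is a pair of its domain and its coordinate map; the values of the
  coordinate map outside the domain are irrelevant.\<close>

type_synonym ('m, 'n) chart = "'m set \<times> ('m \<Rightarrow> real ^ 'n)"

abbreviation chart_dom :: "('m, 'n) chart \<Rightarrow> 'm set" where
  "chart_dom c \<equiv> fst c"

abbreviation chart_map :: "('m, 'n) chart \<Rightarrow> 'm \<Rightarrow> real ^ 'n" where
  "chart_map c \<equiv> snd c"

abbreviation chart_inv :: "('m, 'n) chart \<Rightarrow> real ^ 'n \<Rightarrow> 'm" where
  "chart_inv c \<equiv> inv_into (chart_dom c) (chart_map c)"

abbreviation chart_img :: "('m, 'n) chart \<Rightarrow> (real ^ 'n) set" where
  "chart_img c \<equiv> chart_map c ` chart_dom c"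

definition is_chart :: "'m topology \<Rightarrow> ('m, 'n::finite) chart \<Rightarrow> bool" where
  "is_chart X c \<longleftrightarrow>
     openin X (chart_dom c) \<and> open (chart_img c) \<and>
     homeomorphic_map (subtopology X (chart_dom c)) (top_of_set (chart_img c)) (chart_map c)"

definition transition :: "('m, 'n::finite) chart \<Rightarrow> ('m, 'n) chart \<Rightarrow> real ^ 'n \<Rightarrow> real ^ 'n" where
  "transition c d = chart_map d \<circ> chart_inv c"

definition compatible :: "('m, 'n::finite) chart \<Rightarrow> ('m, 'n) chart \<Rightarrow> bool" where
  "compatible c d \<longleftrightarrow>
     smooth_on (chart_map c ` (chart_dom c \<inter> chart_dom d)) (transition c d) \<and>
     smooth_on (chart_map d ` (chart_dom c \<inter> chart_dom d)) (transition d c)"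

definition smooth_manifold :: "'m topology \<Rightarrow> ('m, 'n::finite) chart set \<Rightarrow> bool" where
  "smooth_manifold X \<A> \<longleftrightarrow>
     Hausdorff_space X \<and> second_countable X \<and>
     (\<forall>c\<in>\<A>. is_chart X c) \<and> (\<Union>c\<in>\<A>. chart_dom c) = topspace X \<and>
     (\<forall>c\<in>\<A>. \<forall>d\<in>\<A>. compatible c d) \<and>
     (\<forall>c. is_chart X c \<and> (\<forall>d\<in>\<A>. compatible c d) \<longrightarrow> c \<in> \<A>)"

definition charts_at :: "('m, 'n) chart set \<Rightarrow> 'm \<Rightarrow> ('m, 'n) chart set" where
  "charts_at \<A> p = {c \<in> \<A>. p \<in> chart_dom c}"

definition smooth_fun :: "('m, 'n::finite) chart set \<Rightarrow> ('m \<Rightarrow> real) \<Rightarrow> bool" where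
  "smooth_fun \<A> f \<longleftrightarrow> (\<forall>c\<in>\<A>. smooth_on (chart_img c) (f \<circ> chart_inv c))"

section \<open>Tangent vectors\<close>

text \<open>A tangent vector at \<open>p\<close> is given by its components in all charts around \<open>p\<close>, related
  by the contravariant transformation law; it is \<open>0\<close> at the other charts, so that equality
  of functions is equality of tangent vectors.\<close>

type_synonym ('m, 'n) tvec = "('m, 'n) chart \<Rightarrow> real ^ 'n"

definition tangent_space :: "('m, 'n::finite) chart set \<Rightarrow> 'm \<Rightarrow> ('m, 'n) tvec set" where
  "tangent_space \<A> p = {v.
     (\<forall>c\<in>charts_at \<A> p. \<forall>d\<in>charts_at \<A> p.
        v d = frechet_derivative (transition c d) (at (chart_map c p)) (v c)) \<and>
     (\<forall>c. c \<notin> charts_at \<A> p \<longrightarrow> v c = 0)}"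

definition tangent_bundle ::
  "'m topology \<Rightarrow> ('m, 'n::finite) chart set \<Rightarrow> ('m \<times> ('m, 'n) tvec) set" where
  "tangent_bundle X \<A> = (SIGMA p:topspace X. tangent_space \<A> p)"

definition tzero :: "('m, 'n::finite) tvec" where
  "tzero = (\<lambda>c. 0)"

definition tadd :: "('m, 'n::finite) tvec \<Rightarrow> ('m, 'n) tvec \<Rightarrow> ('m, 'n) tvec" where
  "tadd v w = (\<lambda>c. v c + w c)"

definition tdiff :: "('m, 'n::finite) tvec \<Rightarrow> ('m, 'n) tvec \<Rightarrow> ('m, 'n) tvec" where
  "tdiff v w = (\<lambda>c. v c - w c)"

definition tscale :: "real \<Rightarrow> ('m, 'n::finite) tvec \<Rightarrow> ('m, 'n) tvec" where
  "tscale r v = (\<lambda>c. r *\<^sub>R v c)"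

text \<open>The coordinate vector \<open>\<partial>/\<partial>x\<^sup>i\<close> of the chart \<open>c\<close> at \<open>p\<close>.\<close>

definition coord_vec ::
  "('m, 'n::finite) chart set \<Rightarrow> ('m, 'n) chart \<Rightarrow> 'n \<Rightarrow> 'm \<Rightarrow> ('m, 'n) tvec" where
  "coord_vec \<A> c i p = (\<lambda>d. if d \<in> charts_at \<A> p
     then frechet_derivative (transition c d) (at (chart_map c p)) (axis i 1) else 0)"

section \<open>Vector fields and Riemannian metrics\<close>

definition vector_field ::
  "'m topology \<Rightarrow> ('m, 'n::finite) chart set \<Rightarrow> ('m \<Rightarrow> ('m, 'n) tvec) \<Rightarrow> bool" where
  "vector_field X \<A> W \<longleftrightarrow>
     (\<forall>p\<in>topspace X. W p \<in> tangent_space \<A> p) \<and>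
     (\<forall>c\<in>\<A>. smooth_on (chart_img c) (\<lambda>x. W (chart_inv c x) c))"

definition inner_product_on ::
  "('m, 'n::finite) tvec set \<Rightarrow> (('m, 'n) tvec \<Rightarrow> ('m, 'n) tvec \<Rightarrow> real) \<Rightarrow> bool" where
  "inner_product_on V g \<longleftrightarrow>
     (\<forall>u\<in>V. \<forall>v\<in>V. g u v = g v u) \<and>
     (\<forall>u\<in>V. \<forall>v\<in>V. \<forall>w\<in>V. g (tadd u v) w = g u w + g v w) \<and>
     (\<forall>r. \<forall>u\<in>V. \<forall>v\<in>V. g (tscale r u) v = r * g u v) \<and>
     (\<forall>v\<in>V. v \<noteq> tzero \<longrightarrow> g v v > 0)"

definition riemannian_metric ::
  "'m topology \<Rightarrow> ('m, 'n::finite) chart set \<Rightarrow>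
   ('m \<Rightarrow> ('m, 'n) tvec \<Rightarrow> ('m, 'n) tvec \<Rightarrow> real) \<Rightarrow> bool" where
  "riemannian_metric X \<A> h \<longleftrightarrow>
     (\<forall>p\<in>topspace X. inner_product_on (tangent_space \<A> p) (h p)) \<and>
     (\<forall>c\<in>\<A>. \<forall>i j. smooth_on (chart_img c)
        (\<lambda>x. h (chart_inv c x) (coord_vec \<A> c i (chart_inv c x)) (coord_vec \<A> c j (chart_inv c x))))"

definition metric_norm ::
  "('m \<Rightarrow> ('m, 'n) tvec \<Rightarrow> ('m, 'n) tvec \<Rightarrow> real) \<Rightarrow> 'm \<Rightarrow> ('m, 'n) tvec \<Rightarrow> real" where
  "metric_norm h p v = sqrt (h p v v)"

definition unit_field ::
  "'m topology \<Rightarrow> ('m \<Rightarrow> ('m, 'n) tvec \<Rightarrow> ('m, 'n) tvec \<Rightarrow> real) \<Rightarrow> ('m \<Rightarrow> ('m, 'n) tvec) \<Rightarrow> bool"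
  where "unit_field X h W \<longleftrightarrow> (\<forall>p\<in>topspace X. h p (W p) (W p) = 1)"

section \<open>U-Kropina metrics\<close>

text \<open>In coordinates, \<open>kropina_a k h\<close> has the components \<open>a\<^sub>i\<^sub>j = e\<^sup>-\<^sup>k h\<^sub>i\<^sub>j\<close>, and
  \<open>kropina_\<beta>\<close> is \<open>b\<^sub>i y\<^sup>i\<close> with \<open>b\<^sub>i = 2 e\<^sup>-\<^sup>k h\<^sub>i\<^sub>j W\<^sup>j\<close>.\<close>

definition kropina_a ::
  "('m \<Rightarrow> real) \<Rightarrow> ('m \<Rightarrow> ('m, 'n) tvec \<Rightarrow> ('m, 'n) tvec \<Rightarrow> real) \<Rightarrow>
   'm \<Rightarrow> ('m, 'n) tvec \<Rightarrow> ('m, 'n) tvec \<Rightarrow> real" where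
  "kropina_a k h p u v = exp (- k p) * h p u v"

definition kropina_\<alpha> ::
  "('m \<Rightarrow> real) \<Rightarrow> ('m \<Rightarrow> ('m, 'n) tvec \<Rightarrow> ('m, 'n) tvec \<Rightarrow> real) \<Rightarrow> 'm \<Rightarrow> ('m, 'n) tvec \<Rightarrow> real"
  where "kropina_\<alpha> k h p y = sqrt (kropina_a k h p y y)"

definition kropina_\<beta> ::
  "('m \<Rightarrow> real) \<Rightarrow> ('m \<Rightarrow> ('m, 'n) tvec \<Rightarrow> ('m, 'n) tvec \<Rightarrow> real) \<Rightarrow> ('m \<Rightarrow> ('m, 'n) tvec) \<Rightarrow>
   'm \<Rightarrow> ('m, 'n) tvec \<Rightarrow> real"
  where "kropina_\<beta> k h W p y = 2 * exp (- k p) * h p (W p) y"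

text \<open>Here and below, a function with domain \<open>A\<close> is a set \<open>A\<close> together with a total function
  of which only the values on \<open>A\<close> matter.\<close>

definition U_Kropina_metric ::
  "'m topology \<Rightarrow> ('m, 'n::finite) chart set \<Rightarrow> ('m \<times> ('m, 'n) tvec) set \<Rightarrow>
   ('m \<times> ('m, 'n) tvec \<Rightarrow> real) \<Rightarrow> bool" where
  "U_Kropina_metric X \<A> A F \<longleftrightarrow>
     (\<exists>h W k. riemannian_metric X \<A> h \<and> vector_field X \<A> W \<and> unit_field X h W \<and> smooth_fun \<A> k \<and>
        A = {(p, y) \<in> tangent_bundle X \<A>. kropina_\<beta> k h W p y > 0} \<and>
        (\<forall>(p, y)\<in>A. F (p, y) = (kropina_\<alpha> k h p y)\<^sup>2 / kropina_\<beta> k h W p y))"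

section \<open>Zermelo's navigation problem\<close>

definition zermelo_eq ::
  "('m \<Rightarrow> ('m, 'n::finite) tvec \<Rightarrow> ('m, 'n) tvec \<Rightarrow> real) \<Rightarrow> ('m \<Rightarrow> ('m, 'n) tvec) \<Rightarrow>
   'm \<Rightarrow> ('m, 'n) tvec \<Rightarrow> real \<Rightarrow> bool" where
  "zermelo_eq h W p y t \<longleftrightarrow> metric_norm h p (tdiff (tscale (1 / t) y) (W p)) = 1"

definition zermelo_solution ::
  "'m topology \<Rightarrow> ('m, 'n::finite) chart set \<Rightarrow>
   ('m \<Rightarrow> ('m, 'n) tvec \<Rightarrow> ('m, 'n) tvec \<Rightarrow> real) \<Rightarrow> ('m \<Rightarrow> ('m, 'n) tvec) \<Rightarrow>
   ('m \<times> ('m, 'n) tvec) set \<Rightarrow> ('m \<times> ('m, 'n) tvec \<Rightarrow> real) \<Rightarrow> bool" where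
  "zermelo_solution X \<A> h W A F \<longleftrightarrow>
     A = {(p, y) \<in> tangent_bundle X \<A>. y \<noteq> tzero \<and> (\<exists>t>0. zermelo_eq h W p y t)} \<and>
     (\<forall>(p, y)\<in>A. F (p, y) > 0 \<and> zermelo_eq h W p y (F (p, y)))"

end

theory Submission
  imports Defs
begin

text \<open>Since \<open>h(W,W) = 1\<close>, expanding the square in \<open>\<bar>y/t - W\<bar>\<^sup>2 = 1\<close> makes the constant
  terms cancel and leaves \<open>h(y,y) = 2 t h(W,y)\<close>. For \<open>y \<noteq> 0\<close> this has a positive root \<open>t\<close> iff
  \<open>h(W,y) > 0\<close>, and then the root is \<open>h(y,y) / (2 h(W,y)) = \<alpha>\<^sup>2/\<beta>\<close>, in which the factors
  \<open>e\<^sup>-\<^sup>k\<close> cancel. Hence the same \<open>(h, W)\<close> serve both descriptions, with any \<open>k\<close>, for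
  instance \<open>k = 0\<close>.\<close>

lemma Ck_on_const: "Ck_on k S (\<lambda>x. c)"
  \<comment> \<open>The derivative of a constant map is the constant 0, so the induction hypothesis
    is needed at another constant.\<close>
  by (induction k arbitrary: c) auto

lemma smooth_fun_const: "smooth_fun \<A> (\<lambda>p. c)"
  by (simp add: smooth_fun_def smooth_on_def comp_def Ck_on_const)

text \<open>Transition maps are smooth on chart overlaps, so order one of \<open>Ck_on\<close>
  already gives a genuine derivative at \<open>chart_map c p\<close>. Its linearity is what lets the
  transformation law survive \<open>tscale\<close> and \<open>tadd\<close>.\<close>

lemma linear_transition_derivative:
  assumes "smooth_manifold X \<A>" "c \<in> charts_at \<A> p" "d \<in> charts_at \<A> p"
  shows "linear (frechet_derivative (transition c d) (at (chart_map c p)))"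
proof -
  have "compatible c d" and p: "chart_map c p \<in> chart_map c ` (chart_dom c \<inter> chart_dom d)"
    using assms by (auto simp: smooth_manifold_def charts_at_def)
  then have "Ck_on (Suc 0) (chart_map c ` (chart_dom c \<inter> chart_dom d)) (transition c d)"
    unfolding compatible_def smooth_on_def by blast
  then have "transition c d differentiable (at (chart_map c p))"
    using p by auto
  then show ?thesis
    by (rule linear_frechet_derivative)
qed

lemma tangent_space_transform:
  assumes "v \<in> tangent_space \<A> p" "c \<in> charts_at \<A> p" "d \<in> charts_at \<A> p"
  shows "v d = frechet_derivative (transition c d) (at (chart_map c p)) (v c)"
  using assms unfolding tangent_space_def by blast

lemma tangent_space_outside:
  assumes "v \<in> tangent_space \<A> p" "c \<notin> charts_at \<A> p"
  shows "v c = 0"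
  using assms unfolding tangent_space_def by blast

lemma tangent_spaceI:
  assumes "\<And>c d. c \<in> charts_at \<A> p \<Longrightarrow> d \<in> charts_at \<A> p \<Longrightarrow>
      v d = frechet_derivative (transition c d) (at (chart_map c p)) (v c)"
    and "\<And>c. c \<notin> charts_at \<A> p \<Longrightarrow> v c = 0"
  shows "v \<in> tangent_space \<A> p"
  using assms unfolding tangent_space_def by blast

lemma tscale_in_tangent_space:
  assumes M: "smooth_manifold X \<A>" and v: "v \<in> tangent_space \<A> p"
  shows "tscale r v \<in> tangent_space \<A> p"
proof (rule tangent_spaceI)
  fix c d
  assume cd: "c \<in> charts_at \<A> p" "d \<in> charts_at \<A> p"
  show "tscale r v d = frechet_derivative (transition c d) (at (chart_map c p)) (tscale r v c)"
    unfolding tscale_def linear_cmul[OF linear_transition_derivative[OF M cd]]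
    by (rule arg_cong[OF tangent_space_transform[OF v cd]])
qed (simp add: tscale_def tangent_space_outside[OF v])

lemma tadd_in_tangent_space:
  assumes M: "smooth_manifold X \<A>"
    and v: "v \<in> tangent_space \<A> p" and w: "w \<in> tangent_space \<A> p"
  shows "tadd v w \<in> tangent_space \<A> p"
proof (rule tangent_spaceI)
  fix c d
  assume cd: "c \<in> charts_at \<A> p" "d \<in> charts_at \<A> p"
  show "tadd v w d = frechet_derivative (transition c d) (at (chart_map c p)) (tadd v w c)"
    unfolding tadd_def linear_add[OF linear_transition_derivative[OF M cd]]
    by (rule arg_cong2[OF tangent_space_transform[OF v cd] tangent_space_transform[OF w cd]])
qed (simp add: tadd_def tangent_space_outside[OF v] tangent_space_outside[OF w])

text \<open>Used to see that a vector with h(W,y) > 0 is nonzero. Since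
  \<open>tscale 0 tzero\<close> is \<open>tzero\<close> again, homogeneity in the first slot gives
  the value 0, and symmetry moves it to the second slot.\<close>

lemma inner_product_on_tzero:
  assumes "inner_product_on V g" "v \<in> V" "tzero \<in> V"
  shows "g v tzero = 0"
proof -
  have "g (tscale 0 tzero) v = 0 * g tzero v"
    using assms unfolding inner_product_on_def by blast
  then have "g tzero v = 0"
    by (simp add: tscale_def tzero_def)
  then show ?thesis
    using assms unfolding inner_product_on_def by metis
qed

text \<open>Bilinearity of \<open>g\<close> is available only on \<open>V\<close>, so the square is
  expanded by writing the difference through \<open>tadd\<close> and \<open>tscale\<close>, under
  which \<open>V\<close> is closed.\<close>

lemma inner_product_on_tdiff_self:
  assumes g: "inner_product_on V g"
    and add_closed: "\<And>x y. x \<in> V \<Longrightarrow> y \<in> V \<Longrightarrow> tadd x y \<in> V"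
    and scale_closed: "\<And>s x. x \<in> V \<Longrightarrow> tscale s x \<in> V"
    and V: "u \<in> V" "v \<in> V"
  shows "g (tdiff u v) (tdiff u v) = g u u - 2 * g v u + g v v"
proof -
  have sym: "g x y = g y x" and cmul: "g (tscale s x) y = s * g x y"
    if "x \<in> V" "y \<in> V" for x y s
    using g that unfolding inner_product_on_def by blast+
  have add: "g (tadd x y) z = g x z + g y z" if "x \<in> V" "y \<in> V" "z \<in> V" for x y z
    using g that unfolding inner_product_on_def by blast
  have eq: "tdiff u v = tadd u (tscale (-1) v)"
    by (auto simp: tdiff_def tadd_def tscale_def)
  have D: "tdiff u v \<in> V"
    unfolding eq using V by (intro add_closed scale_closed)
  have left: "g (tdiff u v) z = g u z - g v z" if "z \<in> V" for z
    unfolding eq using V that by (simp add: add cmul scale_closed)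
  have "g (tdiff u v) (tdiff u v) = g (tdiff u v) u - g (tdiff u v) v"
    using left[OF D] sym[OF V(1) D] sym[OF V(2) D] by simp
  then show ?thesis
    using left V sym[OF V] by simp
qed

lemma zermelo_eq_iff:
  assumes M: "smooth_manifold X \<A>"
    and h: "inner_product_on (tangent_space \<A> p) (h p)"
    and W: "W p \<in> tangent_space \<A> p" "h p (W p) (W p) = 1"
    and y: "y \<in> tangent_space \<A> p" and t: "t > 0"
  shows "zermelo_eq h W p y t \<longleftrightarrow> h p y y = 2 * t * h p (W p) y"
proof -
  have sy: "tscale (1 / t) y \<in> tangent_space \<A> p"
    using M y by (rule tscale_in_tangent_space)
  have sym: "h p x z = h p z x" and cmul: "h p (tscale s x) z = s * h p x z"
    if "x \<in> tangent_space \<A> p" "z \<in> tangent_space \<A> p" for x z s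
    using h that unfolding inner_product_on_def by blast+
  have "h p (W p) (tscale (1 / t) y) = h p (W p) y / t"
    using sym[OF W(1) sy] sym[OF W(1) y] cmul[OF y W(1), of "1 / t"] by simp
  moreover have "h p (tscale (1 / t) y) (tscale (1 / t) y) = h p y y / t\<^sup>2"
    using cmul[OF y sy, of "1 / t"] sym[OF y sy] cmul[OF y y, of "1 / t"]
    by (simp add: power2_eq_square)
  ultimately have "h p (tdiff (tscale (1 / t) y) (W p)) (tdiff (tscale (1 / t) y) (W p))
      = h p y y / t\<^sup>2 - 2 * (h p (W p) y / t) + 1"
    using inner_product_on_tdiff_self[OF h tadd_in_tangent_space[OF M]
        tscale_in_tangent_space[OF M] sy W(1)] W(2) by simp
  \<comment> \<open>The norm is 1 exactly when its square is 1, and this 1 cancels against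
    h(W,W).\<close>
  then have "zermelo_eq h W p y t \<longleftrightarrow> h p y y / t\<^sup>2 = 2 * (h p (W p) y / t)"
    by (simp add: zermelo_eq_def metric_norm_def)
  also have "\<dots> \<longleftrightarrow> h p y y = 2 * t * h p (W p) y"
    using t by (auto simp: field_simps power2_eq_square)
  finally show ?thesis .
qed

text \<open>The function \<open>k\<close> is arbitrary here: one direction of the theorem applies
  this to the given \<open>k\<close>, the other to a \<open>k\<close> of free choice.\<close>

lemma zermelo_solution_iff_kropina:
  assumes M: "smooth_manifold X \<A>"
    and h: "riemannian_metric X \<A> h"
    and W: "vector_field X \<A> W" "unit_field X h W"
  shows "zermelo_solution X \<A> h W A F \<longleftrightarrow>
    A = {(p, y) \<in> tangent_bundle X \<A>. kropina_\<beta> k h W p y > 0} \<and>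
    (\<forall>(p, y)\<in>A. F (p, y) = (kropina_\<alpha> k h p y)\<^sup>2 / kropina_\<beta> k h W p y)"
proof -
  let ?A = "{(p, y) \<in> tangent_bundle X \<A>. kropina_\<beta> k h W p y > 0}"
  let ?B = "{(p, y) \<in> tangent_bundle X \<A>. y \<noteq> tzero \<and> (\<exists>t>0. zermelo_eq h W p y t)}"
  have fibre: "inner_product_on (tangent_space \<A> p) (h p)" "W p \<in> tangent_space \<A> p"
      "h p (W p) (W p) = 1" "y \<in> tangent_space \<A> p"
    if "(p, y) \<in> tangent_bundle X \<A>" for p y
    using that h W by (auto simp: tangent_bundle_def riemannian_metric_def vector_field_def
        unit_field_def)
  have eq: "zermelo_eq h W p y t \<longleftrightarrow> h p y y = 2 * t * h p (W p) y"
    if "(p, y) \<in> tangent_bundle X \<A>" "t > 0" for p y t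
    using zermelo_eq_iff[where h = h and W = W and p = p, OF M fibre[OF that(1)] that(2)] .
  have pos: "h p y y > 0" if "(p, y) \<in> tangent_bundle X \<A>" "y \<noteq> tzero" for p y
    using fibre[OF that(1)] that(2) unfolding inner_product_on_def by blast
  have beta: "kropina_\<beta> k h W p y > 0 \<longleftrightarrow> h p (W p) y > 0" for p y
    by (simp add: kropina_\<beta>_def zero_less_mult_iff)
  \<comment> \<open>The Kropina domain excludes zero vectors only implicitly, through the sign of
    \<beta>.\<close>
  have nonzero: "y \<noteq> tzero" if "(p, y) \<in> tangent_bundle X \<A>" "h p (W p) y > 0" for p y
    using inner_product_on_tzero[OF fibre(1,2)[OF that(1)]] fibre(4)[OF that(1)] that(2) by auto
  have quot: "(kropina_\<alpha> k h p y)\<^sup>2 / kropina_\<beta> k h W p y = h p y y / (2 * h p (W p) y)"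
    if "(p, y) \<in> ?A" for p y
  proof -
    \<comment> \<open>Positivity ensures that squaring the root in \<alpha> gives back the
      radicand.\<close>
    have "h p y y > 0"
      using that pos[of p y] nonzero[of p y] beta[of p y] by blast
    then show ?thesis
      by (simp add: kropina_\<alpha>_def kropina_\<beta>_def kropina_a_def)
  qed
  have "?B = ?A"
  proof (intro equalityI subsetI; clarify)
    fix p y t
    assume y: "(p, y) \<in> tangent_bundle X \<A>" "y \<noteq> tzero"
      and t: "t > 0" and sol: "zermelo_eq h W p y t"
    \<comment> \<open>The right-hand side equals h(y,y) > 0, so with t > 0 the factor h(W,y) must be
      positive.\<close>
    have "0 < 2 * t * h p (W p) y"
      using pos[OF y] sol[unfolded eq[OF y(1) t]] by simp
    with t show "kropina_\<beta> k h W p y > 0"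
      by (simp add: beta zero_less_mult_iff)
  next
    fix p y
    assume y: "(p, y) \<in> tangent_bundle X \<A>" and "kropina_\<beta> k h W p y > 0"
    then have Wy: "h p (W p) y > 0"
      by (simp add: beta)
    \<comment> \<open>The root of the equation h(y,y) = 2 t h(W,y), which is linear in t.\<close>
    define t where "t = h p y y / (2 * h p (W p) y)"
    have "t > 0" "h p y y = 2 * t * h p (W p) y"
      using pos[OF y nonzero[OF y Wy]] Wy by (auto simp: t_def)
    then show "y \<noteq> tzero \<and> (\<exists>t>0. zermelo_eq h W p y t)"
      using eq[OF y] nonzero[OF y Wy] by blast
  qed
  moreover have "F (p, y) > 0 \<and> zermelo_eq h W p y (F (p, y)) \<longleftrightarrow>
      F (p, y) = (kropina_\<alpha> k h p y)\<^sup>2 / kropina_\<beta> k h W p y" if "(p, y) \<in> ?A" for p y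
  proof -
    have y: "(p, y) \<in> tangent_bundle X \<A>" and Wy: "h p (W p) y > 0"
      using that beta by auto
    have root_pos: "0 < h p y y / (2 * h p (W p) y)"
      using pos[OF y nonzero[OF y Wy]] Wy by simp
    have root: "h p y y = 2 * s * h p (W p) y \<longleftrightarrow> s = h p y y / (2 * h p (W p) y)" for s
      using Wy by (auto simp: field_simps)
    show ?thesis
    \<comment> \<open>The reduction \<open>eq\<close> holds for positive times only. A nonpositive
      value of \<open>F\<close> fails both sides, since the quotient is positive.\<close>
    proof (cases "F (p, y) > 0")
      case True
      then show ?thesis
        unfolding quot[OF that] eq[OF y True] root by blast
    next
      case False
      then show ?thesis
        unfolding quot[OF that] using root_pos by metis
    qed
  qed
  \<comment> \<open>Once the domains agree, the value conditions need to be compared only at points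
    of the common domain.\<close>
  ultimately show ?thesis
    unfolding zermelo_solution_def by (intro conj_cong ball_cong) blast+
qed

theorem proposition2p4:
  fixes X :: "'m topology"
    and \<A> :: "('m, 'n::finite) chart set"
    and A :: "('m \<times> ('m, 'n) tvec) set"
    and F :: "'m \<times> ('m, 'n) tvec \<Rightarrow> real"
  assumes "smooth_manifold X \<A>"
    and "CARD('n) \<ge> 2"
    and "A \<subseteq> tangent_bundle X \<A>"
    and "\<forall>z\<in>A. F z > 0"
  shows "U_Kropina_metric X \<A> A F \<longleftrightarrow>
    (\<exists>h W. riemannian_metric X \<A> h \<and> vector_field X \<A> W \<and> unit_field X h W \<and>
       zermelo_solution X \<A> h W A F)"
proof
  assume "U_Kropina_metric X \<A> A F"
  then obtain h W k where hW: "riemannian_metric X \<A> h" "vector_field X \<A> W" "unit_field X h W"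
    and AF: "A = {(p, y) \<in> tangent_bundle X \<A>. kropina_\<beta> k h W p y > 0} \<and>
      (\<forall>(p, y)\<in>A. F (p, y) = (kropina_\<alpha> k h p y)\<^sup>2 / kropina_\<beta> k h W p y)"
    unfolding U_Kropina_metric_def by (elim exE conjE) (rule that, assumption+, rule conjI)
  have "zermelo_solution X \<A> h W A F"
    unfolding zermelo_solution_iff_kropina[OF assms(1) hW, of A F k] by (rule AF)
  with hW show "\<exists>h W. riemannian_metric X \<A> h \<and> vector_field X \<A> W \<and> unit_field X h W \<and>
      zermelo_solution X \<A> h W A F"
    by (intro exI conjI)
next
  assume "\<exists>h W. riemannian_metric X \<A> h \<and> vector_field X \<A> W \<and> unit_field X h W \<and>
      zermelo_solution X \<A> h W A F"
  then obtain h W where hW: "riemannian_metric X \<A> h" "vector_field X \<A> W" "unit_field X h W"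
    and sol: "zermelo_solution X \<A> h W A F"
    by (elim exE conjE)
  show "U_Kropina_metric X \<A> A F"
    unfolding U_Kropina_metric_def
    by (rule exI[of _ h], rule exI[of _ W], rule exI[of _ "\<lambda>p. 0"],
        intro conjI[OF hW(1)] conjI[OF hW(2)] conjI[OF hW(3)] conjI[OF smooth_fun_const])
      (rule zermelo_solution_iff_kropina[OF assms(1) hW, THEN iffD1, OF sol])
qed

end
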